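(* Let $\Phi\in L^0(\Theta,\mathbb{R})$ and $\mu_1,\mu_2\in\mathcal{P}(\Theta)$ be such that $(\mu_i)_\Phi\in\mathcal{P}(\Theta)$ for $i=1,2$ and $c\leq\frac{\mathrm{d}\mu_2}{\mathrm{d}\mu_1}\leq C$ $\mu_1$-a.s. for some $0<c<C<\infty$. (i) If in addition $\operatorname{ess\,inf}_{\mu_1}\Phi=0$, then $$d_{\mathrm{TV}}((\mu_1)_\Phi,(\mu_2)_\Phi)\leq\frac12\,\frac{1}{Z_{\Phi,\mu_1}\wedge Z_{\Phi,\mu_2}}\left\Vert\frac{\mathrm{d}\mu_2}{\mathrm{d}\mu_1}\right\Vert_{L^\infty_{\mu_1}}\left\Vert\log\frac{Z_{\Phi,\mu_2}}{Z_{\Phi,\mu_1}}-\log\frac{\mathrm{d}\mu_2}{\mathrm{d}\mu_1}\right\Vert_{L^1_{\mu_1}},$$ and $\left|\log\frac{Z_{\Phi,\mu_2}}{Z_{\Phi,\mu_1}}\right|\leq 2(Z_{\Phi,\mu_1}\wedge Z_{\Phi,\mu_2})^{-1}d_{\mathrm{TV}}(\mu_1,\mu_2)$. (ii) If in addition $\Phi\in L^\infty_{\mu_1}$, then $$d_{\mathrm{TV}}((\mu_1)_\Phi,(\mu_2)_\Phi)\geq\frac12\,\frac{\exp(-\Vert\Phi\Vert_{L^\infty_{\mu_1}})}{Z_{\Phi,\mu_1}\vee Z_{\Phi,\mu_2}}\left\Vert\left(\frac{\mathrm{d}\mu_2}{\mathrm{d}\mu_1}\right)^{-1}\right\Ve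rt_{L^\infty_{\mu_1}}\left\Vert\log\frac{Z_{\Phi,\mu_2}}{Z_{\Phi,\mu_1}}-\log\frac{\mathrm{d}\mu_2}{\mathrm{d}\mu_1}\right\Vert_{L^1_{\mu_1}}.$$
   Context: $(\Theta,\Sigma)$ is a measurable space and $\mathcal{P}(\Theta)$ is the set of probability measures on it. $L^0(\Theta,\mathbb{R})$ is the set of $\Sigma$-measurable functions $\Theta\to\mathbb{R}$, $L^\infty_\mu$ is the set of $\mu$-essentially bounded ones, and $\Vert f\Vert_{L^1_\mu}:=\int|f|\,\mathrm{d}\mu$. $\frac{\mathrm{d}\mu_2}{\mathrm{d}\mu_1}$ denotes the Radon--Nikodym derivative of $\mu_2$ with respect to $\mu_1$; its existence (that is, $\mu_2\ll\mu_1$) is part of the hypothesis. For $\Phi\in L^0(\Theta,\mathbb{R})$ and $\mu\in\mathcal{P}(\Theta)$: $Z_{\Phi,\mu}:=\int e^{-\Phi}\,\mathrm{d}\mu$; if $0<Z_{\Phi,\mu}<\infty$, then $\mu_\Phi$ is the measure with $\frac{\mathrm{d}\mu_\Phi}{\mathrm{d}\mu}=e^{-\Phi}/Z_{\Phi,\mu}$. The requirement $\mu_\Phi\in\mathcal{P}(\Theta)$ means $0<Z_{\Phi,\mu}<\infty$. The total variation metric is $d_{\mathrm{TV}}(\mu_1,\mu_2):=\sup_{A\in\Sigma}|\mu_1(A)-\mu_2(A)|=\frac12\int\left|\frac{\mathrm{d}\mu_1}{\mathrm{d}\nu}-\frac{\mathrm{d}\mu_2}{\mathrm{d}\nu}\right|\mathrm{d}\nu$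 for any $\nu\in\mathcal{P}(\Theta)$ with $\mu_1,\mu_2\ll\nu$. $a\wedge b:=\min\{a,b\}$, $a\vee b:=\max\{a,b\}$.
   Formalization: In (ii) the factor ‖(dμ₂/dμ₁)^{-1}‖_{L^∞} is replaced by its reciprocal ‖(dμ₂/dμ₁)^{-1}‖_{L^∞}^{-1}; as printed (ii) is false, e.g. two points, μ₁ uniform, dμ₂/dμ₁=(1/2,3/2), Φ=0 gives d_TV=1/4 but right side (ln 3)/2≈0.55. *)

theory Defs
  imports "HOL-Probability.Probability"
begin

text \<open>The Radon--Nikodym derivative \<open>d\<mu>\<^sub>2/d\<mu>\<^sub>1\<close> as a real function. The library's \<open>RN_deriv \<mu>\<^sub>1 \<mu>\<^sub>2\<close>
  takes values in \<open>ennreal\<close>; for a finite \<open>\<mu>\<^sub>2\<close> it is finite \<open>\<mu>\<^sub>1\<close>-almost everywhere. It is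
  meaningful only together with \<open>absolutely_continuous \<mu>\<^sub>1 \<mu>\<^sub>2\<close>.\<close>

definition rn_real :: "'a measure \<Rightarrow> 'a measure \<Rightarrow> 'a \<Rightarrow> real" where
  "rn_real \<mu>\<^sub>1 \<mu>\<^sub>2 x = enn2real (RN_deriv \<mu>\<^sub>1 \<mu>\<^sub>2 x)"

text \<open>The value \<open>\<infinity>\<close> means that \<open>exp (- \<Phi>)\<close> is not \<open>\<mu>\<close>-integrable.\<close>

definition Z_const :: "('a \<Rightarrow> real) \<Rightarrow> 'a measure \<Rightarrow> ennreal" where
  "Z_const \<Phi> \<mu> = (\<integral>\<^sup>+ x. ennreal (exp (- \<Phi> x)) \<partial>\<mu>)"

definition posterior :: "'a measure \<Rightarrow> ('a \<Rightarrow> real) \<Rightarrow> 'a measure" where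
  "posterior \<mu> \<Phi> = density \<mu> (\<lambda>x. ennreal (exp (- \<Phi> x)) / Z_const \<Phi> \<mu>)"

definition tv_dist :: "'a measure \<Rightarrow> 'a measure \<Rightarrow> real" where
  "tv_dist \<mu>\<^sub>1 \<mu>\<^sub>2 = (SUP A\<in>sets \<mu>\<^sub>1. \<bar>measure \<mu>\<^sub>1 A - measure \<mu>\<^sub>2 A\<bar>)"

definition essinf :: "'a measure \<Rightarrow> ('a \<Rightarrow> real) \<Rightarrow> ereal" where
  "essinf \<mu> f = - esssup \<mu> (\<lambda>x. ereal (- f x))"

definition L_infty :: "'a measure \<Rightarrow> ('a \<Rightarrow> real) set" where
  "L_infty \<mu> = {f \<in> borel_measurable \<mu>. esssup \<mu> (\<lambda>x. ereal \<bar>f x\<bar>) < \<infinity>}"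

text \<open>\<open>real_of_ereal\<close> sends \<open>\<infinity>\<close> to \<open>0\<close>, so this is the essential supremum norm only on \<open>L_infty \<mu>\<close>.\<close>

definition norm_Linfty :: "'a measure \<Rightarrow> ('a \<Rightarrow> real) \<Rightarrow> real" where
  "norm_Linfty \<mu> f = real_of_ereal (esssup \<mu> (\<lambda>x. ereal \<bar>f x\<bar>))"

text \<open>The Bochner integral is \<open>0\<close> for non-integrable functions, so this is the \<open>L\<^sup>1\<close> norm only for
  integrable \<open>f\<close>.\<close>

definition norm_L1 :: "'a measure \<Rightarrow> ('a \<Rightarrow> real) \<Rightarrow> real" where
  "norm_L1 \<mu> f = (\<integral>x. \<bar>f x\<bar> \<partial>\<mu>)"

end

theory Submission
  imports Defs
begin

text \<open>Both posteriors have \<open>\<mu>\<^sub>1\<close>-densities, \<open>exp (- \<Phi>) / Z\<^sub>1\<close> and \<open>exp (- \<Phi>) * r / Z\<^sub>2\<close> with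
  \<open>r = d\<mu>\<^sub>2/d\<mu>\<^sub>1\<close>, so their distance is half the integral of \<open>exp (- \<Phi>) * \<bar>1 / Z\<^sub>1 - r / Z\<^sub>2\<bar>\<close>. The mean
  value bounds \<open>min a b * \<bar>ln a - ln b\<bar> \<le> \<bar>a - b\<bar> \<le> max a b * \<bar>ln a - ln b\<bar>\<close> turn the difference into a
  difference of logarithms. The extremes of \<open>1 / Z\<^sub>1\<close> and \<open>r / Z\<^sub>2\<close> are controlled because \<open>r\<close> has
  mean \<open>1\<close>, so that \<open>ess inf r \<le> 1 \<le> ess sup r\<close>.\<close>

section \<open>Difference of two positive numbers against difference of their logarithms\<close>

text \<open>Apply \<open>ln t \<le> t - 1\<close> with \<open>t\<close> the smaller number over the
  larger and multiply by the larger one. The companion bound with \<open>min\<close> takes the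
  opposite quotient.\<close>

lemma abs_diff_le_max_ln:
  fixes a b :: real
  assumes "0 < a" "0 < b"
  shows "\<bar>a - b\<bar> \<le> max a b * \<bar>ln a - ln b\<bar>"
proof -
  have *: "x - y \<le> x * (ln x - ln y)" if "0 < y" "y \<le> x" for x y :: real
  proof -
    have "ln (y / x) \<le> y / x - 1"
      using that by (intro ln_le_minus_one) auto
    then show ?thesis
      using that by (simp add: ln_div field_simps)
  qed
  show ?thesis
    using *[of a b] *[of b a] assms by (cases "a \<le> b") (auto simp: max_def abs_if)
qed

lemma min_ln_le_abs_diff:
  fixes a b :: real
  assumes "0 < a" "0 < b"
  shows "min a b * \<bar>ln a - ln b\<bar> \<le> \<bar>a - b\<bar>"
proof -
  have *: "y * (ln x - ln y) \<le> x - y" if "0 < y" "y \<le> x" for x y :: real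
  proof -
    have "ln (x / y) \<le> x / y - 1"
      using that by (intro ln_le_minus_one) auto
    then show ?thesis
      using that by (simp add: ln_div field_simps)
  qed
  show ?thesis
    using *[of a b] *[of b a] assms by (cases "a \<le> b") (auto simp: min_def abs_if)
qed

section \<open>Total variation distance of measures given by densities\<close>

lemma measure_density_real:
  fixes f :: "'a \<Rightarrow> real"
  assumes f: "integrable M f" "AE x in M. 0 \<le> f x" and A: "A \<in> sets M"
  shows "measure (density M (\<lambda>x. ennreal (f x))) A = (\<integral>x. indicator A x * f x \<partial>M)"
proof -
  have nn: "AE x in M. 0 \<le> indicator A x * f x"
    using f(2) by (rule eventually_mono) simp
  have "emeasure (density M (\<lambda>x. ennreal (f x))) A = (\<integral>\<^sup>+x. ennreal (f x) * indicator A x \<partial>M)"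
    using f A by (intro emeasure_density) auto
  also have "\<dots> = (\<integral>\<^sup>+x. ennreal (indicator A x * f x) \<partial>M)"
    by (intro nn_integral_cong) (auto simp: indicator_def)
  also have "\<dots> = ennreal (\<integral>x. indicator A x * f x \<partial>M)"
  proof (rule nn_integral_eq_integral)
    show "integrable M (\<lambda>x. indicator A x * f x)"
      using integrable_real_mult_indicator[OF A f(1)] by (simp add: mult.commute)
  qed (fact nn)
  finally show ?thesis
    using nn by (simp add: measure_def integral_nonneg_AE)
qed

text \<open>Equal total masses make \<open>f - g\<close> a function of mean zero, so its positive
  and negative parts have the same integral, and the supremum over sets is attained where
  \<open>f - g\<close> is nonnegative.\<close>

lemma tv_dist_density:
  fixes f g :: "'a \<Rightarrow> real"
  assumes f: "integrable M f" "AE x in M. 0 \<le> f x"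
    and g: "integrable M g" "AE x in M. 0 \<le> g x"
    and eq: "(\<integral>x. f x \<partial>M) = (\<integral>x. g x \<partial>M)"
  shows "tv_dist (density M (\<lambda>x. ennreal (f x))) (density M (\<lambda>x. ennreal (g x)))
    = 1 / 2 * (\<integral>x. \<bar>f x - g x\<bar> \<partial>M)"
proof -
  define h where "h x = f x - g x" for x
  have h: "integrable M h" "(\<integral>x. h x \<partial>M) = 0"
    using f(1) g(1) eq by (simp_all add: h_def[abs_def])
  have ind: "integrable M (\<lambda>x. indicator A x * k x)"
    if "A \<in> sets M" "integrable M k" for A and k :: "'a \<Rightarrow> real"
    using integrable_real_mult_indicator[OF that] by (simp add: mult.commute)
  have diff: "measure (density M (\<lambda>x. ennreal (f x))) A - measure (density M (\<lambda>x. ennreal (g x))) A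
      = (\<integral>x. indicator A x * h x \<partial>M)" if A: "A \<in> sets M" for A
    using ind[OF A f(1)] ind[OF A g(1)]
    by (simp add: measure_density_real[OF f A] measure_density_real[OF g A] h_def right_diff_distrib)
  text \<open>As \<open>h\<close> has integral zero, \<open>\<integral>\<^sub>A h = 1/2 (\<integral>\<^sub>A h - \<integral>\<^sub>A\<^sub>c h)\<close>.\<close>
  have half: "2 * (\<integral>x. indicator A x * h x \<partial>M) = (\<integral>x. (2 * indicator A x - 1) * h x \<partial>M)"
    if A: "A \<in> sets M" for A
    using ind[OF A h(1)] h by (simp add: left_diff_distrib mult.assoc)
  have le: "\<bar>\<integral>x. indicator A x * h x \<partial>M\<bar> \<le> 1 / 2 * (\<integral>x. \<bar>h x\<bar> \<partial>M)" if A: "A \<in> sets M" for A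
  proof -
    have "\<bar>\<integral>x. (2 * indicator A x - 1) * h x \<partial>M\<bar> \<le> (\<integral>x. \<bar>(2 * indicator A x - 1) * h x\<bar> \<partial>M)"
      by (rule integral_abs_bound)
    also have "\<dots> = (\<integral>x. \<bar>h x\<bar> \<partial>M)"
      by (intro Bochner_Integration.integral_cong) (auto simp: indicator_def)
    finally show ?thesis
      using half[OF A] by simp
  qed
  \<comment> \<open>On this set of a Hahn decomposition the factor
    \<open>2 * indicator P x - 1\<close> is the sign of \<open>h x\<close>, so the bound
    \<open>le\<close> becomes an equality.\<close>
  define P where "P = {x \<in> space M. 0 \<le> h x}"
  have P: "P \<in> sets M"
    using h(1) unfolding P_def by measurable
  have "(\<integral>x. (2 * indicator P x - 1) * h x \<partial>M) = (\<integral>x. \<bar>h x\<bar> \<partial>M)"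
    by (intro Bochner_Integration.integral_cong) (auto simp: P_def indicator_def)
  then have P_eq: "(\<integral>x. indicator P x * h x \<partial>M) = 1 / 2 * (\<integral>x. \<bar>h x\<bar> \<partial>M)"
    using half[OF P] by simp
  have "(SUP A\<in>sets M. \<bar>\<integral>x. indicator A x * h x \<partial>M\<bar>) = 1 / 2 * (\<integral>x. \<bar>h x\<bar> \<partial>M)"
  proof (rule antisym)
    show "(SUP A\<in>sets M. \<bar>\<integral>x. indicator A x * h x \<partial>M\<bar>) \<le> 1 / 2 * (\<integral>x. \<bar>h x\<bar> \<partial>M)"
      using le by (intro cSUP_least) auto
    \<comment> \<open>Besides bounding the supremum, \<open>le\<close> supplies the
      \<open>bdd_above\<close> condition that a real-valued \<open>SUP\<close> requires.\<close>
    have "\<bar>\<integral>x. indicator P x * h x \<partial>M\<bar> \<le> (SUP A\<in>sets M. \<bar>\<integral>x. indicator A x * h x \<partial>M\<bar>)"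
      using le by (intro cSUP_upper P bdd_aboveI2)
    then show "1 / 2 * (\<integral>x. \<bar>h x\<bar> \<partial>M) \<le> (SUP A\<in>sets M. \<bar>\<integral>x. indicator A x * h x \<partial>M\<bar>)"
      using P_eq by simp
  qed
  then show ?thesis
    by (simp add: tv_dist_def diff h_def)
qed

section \<open>Almost-everywhere bounds from essential suprema and infima\<close>

text \<open>Membership in \<open>L_infty\<close> excludes an infinite essential supremum, which
  \<open>real_of_ereal\<close> would turn into the norm 0.\<close>

lemma AE_abs_le_norm_Linfty:
  assumes "f \<in> L_infty M"
  shows "AE x in M. \<bar>f x\<bar> \<le> norm_Linfty M f"
proof -
  have *: "y \<le> real_of_ereal e" if "ereal y \<le> e" "e < \<infinity>" for y e
    using that by (cases e) auto
  have "esssup M (\<lambda>x. ereal \<bar>f x\<bar>) < \<infinity>"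
    using assms by (simp add: L_infty_def)
  with esssup_AE[of "\<lambda>x. ereal \<bar>f x\<bar>" M] show ?thesis
    unfolding norm_Linfty_def by (auto elim!: eventually_mono intro: *)
qed

lemma L_inftyI:
  assumes "f \<in> borel_measurable M" "AE x in M. \<bar>f x\<bar> \<le> K"
  shows "f \<in> L_infty M"
proof -
  have "esssup M (\<lambda>x. ereal \<bar>f x\<bar>) \<le> ereal K"
    using assms by (intro esssup_I) auto
  then show ?thesis
    using assms(1) le_less_trans by (fastforce simp: L_infty_def)
qed

lemma AE_essinf_le:
  "AE x in M. essinf M f \<le> ereal (f x)"
  using esssup_AE[of "\<lambda>x. ereal (- f x)" M]
  unfolding essinf_def
proof (rule eventually_mono)
  fix x assume "ereal (- f x) \<le> esssup M (\<lambda>x. ereal (- f x))"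
  then show "- esssup M (\<lambda>x. ereal (- f x)) \<le> ereal (f x)"
    by (metis ereal_minus_le_minus ereal_uminus_uminus uminus_ereal.simps(1))
qed

text \<open>The lower bound contains the reciprocal of the norm of \<open>inverse (r x)\<close>,
  that is, the essential infimum of \<open>r\<close>, where the English statement has the norm
  itself. With the norm itself the bound fails: for \<Phi> = 0 and \<open>r\<close> equal to 1/2 and
  3/2 with probability 1/2 each, the distance is 1/4, but the right-hand side would be (ln
  3)/2.\<close>

theorem proposition3p9:
  fixes M \<mu>\<^sub>1 \<mu>\<^sub>2 :: "'a measure" and \<Phi> :: "'a \<Rightarrow> real" and c C :: real
  defines "Z\<^sub>1 \<equiv> enn2real (Z_const \<Phi> \<mu>\<^sub>1)"
    and "Z\<^sub>2 \<equiv> enn2real (Z_const \<Phi> \<mu>\<^sub>2)"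
    and "r \<equiv> rn_real \<mu>\<^sub>1 \<mu>\<^sub>2"
  assumes "\<Phi> \<in> borel_measurable M"
    and "prob_space \<mu>\<^sub>1" and "sets \<mu>\<^sub>1 = sets M"
    and "prob_space \<mu>\<^sub>2" and "sets \<mu>\<^sub>2 = sets M"
    and "0 < Z_const \<Phi> \<mu>\<^sub>1" and "Z_const \<Phi> \<mu>\<^sub>1 < \<infinity>"
    and "0 < Z_const \<Phi> \<mu>\<^sub>2" and "Z_const \<Phi> \<mu>\<^sub>2 < \<infinity>"
    and "absolutely_continuous \<mu>\<^sub>1 \<mu>\<^sub>2"
    and "0 < c" and "c < C"
    and "AE x in \<mu>\<^sub>1. c \<le> r x \<and> r x \<le> C"
  shows "(essinf \<mu>\<^sub>1 \<Phi> = 0 \<longrightarrow>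
            tv_dist (posterior \<mu>\<^sub>1 \<Phi>) (posterior \<mu>\<^sub>2 \<Phi>)
              \<le> 1 / 2 * (1 / min Z\<^sub>1 Z\<^sub>2) * norm_Linfty \<mu>\<^sub>1 r
                  * norm_L1 \<mu>\<^sub>1 (\<lambda>x. ln (Z\<^sub>2 / Z\<^sub>1) - ln (r x))
          \<and> \<bar>ln (Z\<^sub>2 / Z\<^sub>1)\<bar> \<le> 2 * inverse (min Z\<^sub>1 Z\<^sub>2) * tv_dist \<mu>\<^sub>1 \<mu>\<^sub>2)
       \<and> (\<Phi> \<in> L_infty \<mu>\<^sub>1 \<longrightarrow>
            tv_dist (posterior \<mu>\<^sub>1 \<Phi>) (posterior \<mu>\<^sub>2 \<Phi>)
              \<ge> 1 / 2 * (exp (- norm_Linfty \<mu>\<^sub>1 \<Phi>) / max Z\<^sub>1 Z\<^sub>2)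
                  * inverse (norm_Linfty \<mu>\<^sub>1 (\<lambda>x. inverse (r x)))
                  * norm_L1 \<mu>\<^sub>1 (\<lambda>x. ln (Z\<^sub>2 / Z\<^sub>1) - ln (r x)))"
proof -
  interpret P1: prob_space \<mu>\<^sub>1 by fact
  interpret P2: prob_space \<mu>\<^sub>2 by fact
  have [measurable]: "\<Phi> \<in> borel_measurable \<mu>\<^sub>1"
    using assms(4,6) by (simp cong: measurable_cong_sets)
  have r_meas[measurable]: "r \<in> borel_measurable \<mu>\<^sub>1"
    unfolding r_def rn_real_def[abs_def] by measurable
  have r_bounds: "AE x in \<mu>\<^sub>1. c \<le> r x \<and> r x \<le> C" and c: "0 < c" "c < C"
    by fact+
  have r_nonneg: "0 \<le> r x" for x
    by (simp add: r_def rn_real_def)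
  have r_abs: "AE x in \<mu>\<^sub>1. \<bar>r x\<bar> \<le> C"
    using r_bounds by (rule eventually_mono) (use r_nonneg in auto)

  \<comment> \<open>The real-valued derivative as a density of mean one\<close>
  have \<mu>2_RN: "density \<mu>\<^sub>1 (RN_deriv \<mu>\<^sub>1 \<mu>\<^sub>2) = \<mu>\<^sub>2"
    using assms(6,8,13) by (intro P1.density_RN_deriv) auto
  \<comment> \<open>Since \<open>enn2real\<close> sends \<infinity> to 0, the positive lower bound
    \<open>c\<close> rules out the value \<infinity>, and no information is lost in passing to
    \<open>r\<close>.\<close>
  have "AE x in \<mu>\<^sub>1. RN_deriv \<mu>\<^sub>1 \<mu>\<^sub>2 x = ennreal (r x)"
    using r_bounds
  proof (rule eventually_mono)
    fix x assume "c \<le> r x \<and> r x \<le> C"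
    with c have "0 < enn2real (RN_deriv \<mu>\<^sub>1 \<mu>\<^sub>2 x)"
      by (simp add: r_def rn_real_def)
    then show "RN_deriv \<mu>\<^sub>1 \<mu>\<^sub>2 x = ennreal (r x)"
      by (simp add: r_def rn_real_def enn2real_positive_iff)
  qed
  then have \<mu>2: "\<mu>\<^sub>2 = density \<mu>\<^sub>1 (\<lambda>x. ennreal (r x))"
    using \<mu>2_RN by (subst \<mu>2_RN[symmetric], intro density_cong) auto

  have r_int: "integrable \<mu>\<^sub>1 r"
    using r_abs by (intro P1.integrable_const_bound[of _ C]) auto
  have r_1: "(\<integral>x. r x \<partial>\<mu>\<^sub>1) = 1"
  proof -
    have "ennreal (\<integral>x. r x \<partial>\<mu>\<^sub>1) = (\<integral>\<^sup>+x. ennreal (r x) \<partial>\<mu>\<^sub>1)"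
      using r_int r_nonneg by (simp add: nn_integral_eq_integral)
    also have "\<dots> = emeasure \<mu>\<^sub>2 (space \<mu>\<^sub>2)"
      by (subst (1 2) \<mu>2) (simp add: emeasure_density cong: nn_integral_cong)
    finally show ?thesis
      by (simp add: P2.emeasure_space_1)
  qed

  \<comment> \<open>Normalising constants, and densities of both posteriors with respect to the
    first prior\<close>
  define s where "s x = exp (- \<Phi> x)" for x
  have [measurable]: "s \<in> borel_measurable \<mu>\<^sub>1"
    unfolding s_def[abs_def] by measurable
  have s_pos: "0 < s x" for x
    by (simp add: s_def)
  have Z1_enn: "Z_const \<Phi> \<mu>\<^sub>1 = ennreal Z\<^sub>1" and Z2_enn: "Z_const \<Phi> \<mu>\<^sub>2 = ennreal Z\<^sub>2"
    using assms by (auto simp: ennreal_enn2real_if)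
  have Z: "0 < Z\<^sub>1" "0 < Z\<^sub>2"
    using assms by (auto simp: enn2real_positive_iff)
  have "(\<integral>\<^sup>+x. ennreal (s x) \<partial>\<mu>\<^sub>1) = ennreal Z\<^sub>1"
    using Z1_enn by (simp add: Z_const_def s_def)
  then have s_int: "integrable \<mu>\<^sub>1 s" and s_Z1: "(\<integral>x. s x \<partial>\<mu>\<^sub>1) = Z\<^sub>1"
    using nn_integral_eq_integrable[of s \<mu>\<^sub>1 Z\<^sub>1] Z s_pos by (auto simp: less_imp_le)
  \<comment> \<open>Change of measure: \<open>Z\<^sub>2\<close> becomes the
    \<open>\<mu>\<^sub>1\<close>-integral of \<open>s x * r x\<close>, so everything is compared
    under one measure.\<close>
  have "(\<integral>\<^sup>+x. ennreal (s x) \<partial>\<mu>\<^sub>2) = (\<integral>\<^sup>+x. ennreal (r x) * ennreal (s x) \<partial>\<mu>\<^sub>1)"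
    by (subst \<mu>2, intro nn_integral_density) auto
  then have "(\<integral>\<^sup>+x. ennreal (s x * r x) \<partial>\<mu>\<^sub>1) = ennreal Z\<^sub>2"
    using Z2_enn r_nonneg s_pos
    by (simp add: Z_const_def s_def ennreal_mult mult.commute less_imp_le)
  then have sr_int: "integrable \<mu>\<^sub>1 (\<lambda>x. s x * r x)" and sr_Z2: "(\<integral>x. s x * r x \<partial>\<mu>\<^sub>1) = Z\<^sub>2"
    using nn_integral_eq_integrable[of "\<lambda>x. s x * r x" \<mu>\<^sub>1 Z\<^sub>2] Z s_pos r_nonneg
    by (auto simp: less_imp_le)

  have post1: "posterior \<mu>\<^sub>1 \<Phi> = density \<mu>\<^sub>1 (\<lambda>x. ennreal (s x / Z\<^sub>1))"
    using Z s_pos by (simp add: posterior_def Z1_enn s_def divide_ennreal)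
  have "posterior \<mu>\<^sub>2 \<Phi> = density (density \<mu>\<^sub>1 (\<lambda>x. ennreal (r x))) (\<lambda>x. ennreal (s x / Z\<^sub>2))"
    unfolding posterior_def Z2_enn \<mu>2[symmetric] using Z by (simp add: s_def divide_ennreal)
  also have "\<dots> = density \<mu>\<^sub>1 (\<lambda>x. ennreal (r x) * ennreal (s x / Z\<^sub>2))"
    by (intro density_density_eq) auto
  also have "\<dots> = density \<mu>\<^sub>1 (\<lambda>x. ennreal (s x * r x / Z\<^sub>2))"
    using r_nonneg s_pos Z by (simp add: ennreal_mult[symmetric] less_imp_le mult.commute)
  finally have post2: "posterior \<mu>\<^sub>2 \<Phi> = density \<mu>\<^sub>1 (\<lambda>x. ennreal (s x * r x / Z\<^sub>2))" .
  have tv_post: "tv_dist (posterior \<mu>\<^sub>1 \<Phi>) (posterior \<mu>\<^sub>2 \<Phi>)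
      = 1 / 2 * (\<integral>x. \<bar>s x / Z\<^sub>1 - s x * r x / Z\<^sub>2\<bar> \<partial>\<mu>\<^sub>1)"
    unfolding post1 post2 using s_int sr_int s_Z1 sr_Z2 Z s_pos r_nonneg
    by (intro tv_dist_density) (auto simp: less_imp_le)
  have "tv_dist \<mu>\<^sub>1 \<mu>\<^sub>2 = tv_dist (density \<mu>\<^sub>1 (\<lambda>x. ennreal 1)) (density \<mu>\<^sub>1 (\<lambda>x. ennreal (r x)))"
    using \<mu>2 by (simp add: density_1)
  also have "\<dots> = 1 / 2 * (\<integral>x. \<bar>1 - r x\<bar> \<partial>\<mu>\<^sub>1)"
    using r_int r_1 r_nonneg by (intro tv_dist_density) (auto simp: P1.prob_space)
  finally have tv_prior: "tv_dist \<mu>\<^sub>1 \<mu>\<^sub>2 = 1 / 2 * (\<integral>x. \<bar>1 - r x\<bar> \<partial>\<mu>\<^sub>1)" .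

  \<comment> \<open>The logarithmic difference\<close>
  define l where "l x = \<bar>ln (Z\<^sub>2 / Z\<^sub>1) - ln (r x)\<bar>" for x
  have l_meas[measurable]: "l \<in> borel_measurable \<mu>\<^sub>1"
    unfolding l_def[abs_def] by measurable
  \<comment> \<open>Boundedness makes \<open>l\<close> integrable, so \<open>norm_L1\<close> is a
    genuine norm here and not the default 0 of the Bochner integral.\<close>
  have "AE x in \<mu>\<^sub>1. norm (l x) \<le> \<bar>ln (Z\<^sub>2 / Z\<^sub>1)\<bar> + (\<bar>ln c\<bar> + \<bar>ln C\<bar>)"
    using r_bounds
  proof (rule eventually_mono)
    fix x assume x: "c \<le> r x \<and> r x \<le> C"
    then have "ln c \<le> ln (r x)" "ln (r x) \<le> ln C"
      using c by auto
    then show "norm (l x) \<le> \<bar>ln (Z\<^sub>2 / Z\<^sub>1)\<bar> + (\<bar>ln c\<bar> + \<bar>ln C\<bar>)"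
      by (simp add: l_def)
  qed
  then have l_int: "integrable \<mu>\<^sub>1 l"
    by (intro P1.integrable_const_bound) auto
  have l_norm: "norm_L1 \<mu>\<^sub>1 (\<lambda>x. ln (Z\<^sub>2 / Z\<^sub>1) - ln (r x)) = (\<integral>x. l x \<partial>\<mu>\<^sub>1)"
    by (simp add: norm_L1_def l_def)
  \<comment> \<open>Regrouping the four logarithms shows \<open>l\<close> to be the log-difference
    of the two posterior densities with the common factor \<open>s\<close> removed.\<close>
  have l_eq: "l x = \<bar>ln (1 / Z\<^sub>1) - ln (r x / Z\<^sub>2)\<bar>" if "0 < r x" for x
    using that Z by (simp add: l_def ln_div)
  have d_eq: "\<bar>s x / Z\<^sub>1 - s x * r x / Z\<^sub>2\<bar> = s x * \<bar>1 / Z\<^sub>1 - r x / Z\<^sub>2\<bar>" for x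
    using s_pos[of x] abs_mult[of "s x" "1 / Z\<^sub>1 - r x / Z\<^sub>2"] by (simp add: algebra_simps)

  \<comment> \<open>Upper bounds when the essential infimum of \<Phi> is zero\<close>
  have upper: "tv_dist (posterior \<mu>\<^sub>1 \<Phi>) (posterior \<mu>\<^sub>2 \<Phi>)
      \<le> 1 / 2 * (1 / min Z\<^sub>1 Z\<^sub>2) * norm_Linfty \<mu>\<^sub>1 r
          * norm_L1 \<mu>\<^sub>1 (\<lambda>x. ln (Z\<^sub>2 / Z\<^sub>1) - ln (r x))"
    and Z_diff: "\<bar>ln (Z\<^sub>2 / Z\<^sub>1)\<bar> \<le> 2 * inverse (min Z\<^sub>1 Z\<^sub>2) * tv_dist \<mu>\<^sub>1 \<mu>\<^sub>2"
    if "essinf \<mu>\<^sub>1 \<Phi> = 0"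
  proof -
    have s_le: "AE x in \<mu>\<^sub>1. s x \<le> 1"
      using AE_essinf_le[of \<mu>\<^sub>1 \<Phi>] that by (auto simp: s_def)
    define R where "R = norm_Linfty \<mu>\<^sub>1 r"
    have "r \<in> L_infty \<mu>\<^sub>1"
      using r_abs by (intro L_inftyI) auto
    then have r_le: "AE x in \<mu>\<^sub>1. r x \<le> R"
      using AE_abs_le_norm_Linfty unfolding R_def by (fastforce elim!: eventually_mono)
    then have "1 \<le> R"
      using integral_mono_AE[of \<mu>\<^sub>1 r "\<lambda>_. R"] r_int r_1 by (simp add: P1.prob_space)
    have "AE x in \<mu>\<^sub>1. \<bar>s x / Z\<^sub>1 - s x * r x / Z\<^sub>2\<bar> \<le> R / min Z\<^sub>1 Z\<^sub>2 * l x"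
      using s_le r_le r_bounds
    proof eventually_elim
      fix x assume x: "s x \<le> 1" "r x \<le> R" "c \<le> r x \<and> r x \<le> C"
      then have "0 < r x"
        using c by simp
      \<comment> \<open>Both numerators, 1 and \<open>r x\<close>, are at most \<open>R\<close>;
        this is where \<open>1 \<le> R\<close> enters.\<close>
      have "max (1 / Z\<^sub>1) (r x / Z\<^sub>2) \<le> R / min Z\<^sub>1 Z\<^sub>2"
        using \<open>1 \<le> R\<close> x Z by (auto intro!: frac_le)
      then have "\<bar>1 / Z\<^sub>1 - r x / Z\<^sub>2\<bar> \<le> R / min Z\<^sub>1 Z\<^sub>2 * l x"
        using abs_diff_le_max_ln[of "1 / Z\<^sub>1" "r x / Z\<^sub>2"] Z \<open>0 < r x\<close>
        unfolding l_eq[OF \<open>0 < r x\<close>]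
        by (meson abs_ge_zero divide_pos_pos mult_right_mono order_trans zero_less_one)
      moreover have "s x * \<bar>1 / Z\<^sub>1 - r x / Z\<^sub>2\<bar> \<le> \<bar>1 / Z\<^sub>1 - r x / Z\<^sub>2\<bar>"
        using x s_pos[of x] by (intro mult_left_le_one_le) auto
      ultimately show "\<bar>s x / Z\<^sub>1 - s x * r x / Z\<^sub>2\<bar> \<le> R / min Z\<^sub>1 Z\<^sub>2 * l x"
        unfolding d_eq by simp
    qed
    then have "(\<integral>x. \<bar>s x / Z\<^sub>1 - s x * r x / Z\<^sub>2\<bar> \<partial>\<mu>\<^sub>1) \<le> (\<integral>x. R / min Z\<^sub>1 Z\<^sub>2 * l x \<partial>\<mu>\<^sub>1)"
      using s_int sr_int l_int by (intro integral_mono_AE) auto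
    then show "tv_dist (posterior \<mu>\<^sub>1 \<Phi>) (posterior \<mu>\<^sub>2 \<Phi>)
      \<le> 1 / 2 * (1 / min Z\<^sub>1 Z\<^sub>2) * norm_Linfty \<mu>\<^sub>1 r
          * norm_L1 \<mu>\<^sub>1 (\<lambda>x. ln (Z\<^sub>2 / Z\<^sub>1) - ln (r x))"
      unfolding tv_post l_norm R_def[symmetric] by simp

    \<comment> \<open>The constants differ by the integral of \<open>s x * (1 - r x)\<close>.
      Dropping \<open>s \<le> 1\<close> leaves twice the distance of the priors; the logarithmic
      bound is then applied to \<open>Z\<^sub>1\<close> and \<open>Z\<^sub>2\<close>
      themselves.\<close>
    have "\<bar>Z\<^sub>1 - Z\<^sub>2\<bar> = \<bar>\<integral>x. s x - s x * r x \<partial>\<mu>\<^sub>1\<bar>"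
      using s_int sr_int by (simp add: s_Z1 sr_Z2)
    also have "\<dots> \<le> (\<integral>x. \<bar>s x - s x * r x\<bar> \<partial>\<mu>\<^sub>1)"
      by (rule integral_abs_bound)
    also have "\<dots> \<le> (\<integral>x. \<bar>1 - r x\<bar> \<partial>\<mu>\<^sub>1)"
    proof (rule integral_mono_AE)
      show "AE x in \<mu>\<^sub>1. \<bar>s x - s x * r x\<bar> \<le> \<bar>1 - r x\<bar>"
        using s_le
      proof eventually_elim
        fix x assume "s x \<le> 1"
        then have "s x * \<bar>1 - r x\<bar> \<le> \<bar>1 - r x\<bar>"
          using s_pos[of x] by (intro mult_left_le_one_le) auto
        then show "\<bar>s x - s x * r x\<bar> \<le> \<bar>1 - r x\<bar>"
          using s_pos[of x] abs_mult[of "s x" "1 - r x"] by (simp add: right_diff_distrib)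
      qed
    qed (use s_int sr_int r_int in auto)
    also have "\<dots> = 2 * tv_dist \<mu>\<^sub>1 \<mu>\<^sub>2"
      by (simp add: tv_prior)
    finally have "\<bar>Z\<^sub>1 - Z\<^sub>2\<bar> \<le> 2 * tv_dist \<mu>\<^sub>1 \<mu>\<^sub>2" .
    moreover have "min Z\<^sub>1 Z\<^sub>2 * \<bar>ln (Z\<^sub>2 / Z\<^sub>1)\<bar> \<le> \<bar>Z\<^sub>1 - Z\<^sub>2\<bar>"
      using min_ln_le_abs_diff[OF Z] Z by (simp add: ln_div abs_minus_commute)
    ultimately have "min Z\<^sub>1 Z\<^sub>2 * \<bar>ln (Z\<^sub>2 / Z\<^sub>1)\<bar> \<le> 2 * tv_dist \<mu>\<^sub>1 \<mu>\<^sub>2"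
      by simp
    \<comment> \<open>The minimum is kept as one positive quantity to divide by, hence the simp rule
      splitting it is deleted below.\<close>
    moreover have "0 < min Z\<^sub>1 Z\<^sub>2"
      using Z by simp
    ultimately show "\<bar>ln (Z\<^sub>2 / Z\<^sub>1)\<bar> \<le> 2 * inverse (min Z\<^sub>1 Z\<^sub>2) * tv_dist \<mu>\<^sub>1 \<mu>\<^sub>2"
      by (simp add: field_simps del: min_less_iff_conj)
  qed

  \<comment> \<open>Lower bound for essentially bounded \<Phi>\<close>
  have lower: "1 / 2 * (exp (- norm_Linfty \<mu>\<^sub>1 \<Phi>) / max Z\<^sub>1 Z\<^sub>2)
          * inverse (norm_Linfty \<mu>\<^sub>1 (\<lambda>x. inverse (r x)))
          * norm_L1 \<mu>\<^sub>1 (\<lambda>x. ln (Z\<^sub>2 / Z\<^sub>1) - ln (r x))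
      \<le> tv_dist (posterior \<mu>\<^sub>1 \<Phi>) (posterior \<mu>\<^sub>2 \<Phi>)"
    if "\<Phi> \<in> L_infty \<mu>\<^sub>1"
  proof -
    \<comment> \<open>This is to serve as an essential lower bound of \<open>r\<close>. Its
      positivity is not immediate, since \<open>inverse 0 = 0\<close>; it follows from the bound on
      \<open>inverse (r x)\<close>.\<close>
    define q where "q = inverse (norm_Linfty \<mu>\<^sub>1 (\<lambda>x. inverse (r x)))"
    define e where "e = exp (- norm_Linfty \<mu>\<^sub>1 \<Phi>)"
    have s_ge: "AE x in \<mu>\<^sub>1. e \<le> s x"
      using AE_abs_le_norm_Linfty[OF that] by (auto simp: s_def e_def elim!: eventually_mono)
    have "AE x in \<mu>\<^sub>1. \<bar>inverse (r x)\<bar> \<le> inverse c"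
      using r_bounds
      by (rule eventually_mono) (use c in \<open>auto simp: le_imp_inverse_le\<close>)
    then have "(\<lambda>x. inverse (r x)) \<in> L_infty \<mu>\<^sub>1"
      by (intro L_inftyI) auto
    then have "AE x in \<mu>\<^sub>1. \<bar>inverse (r x)\<bar> \<le> inverse q"
      using AE_abs_le_norm_Linfty by (fastforce simp: q_def)
    then have q: "AE x in \<mu>\<^sub>1. 0 < q \<and> q \<le> r x"
      using r_bounds
    proof eventually_elim
      fix x assume x: "\<bar>inverse (r x)\<bar> \<le> inverse q" "c \<le> r x \<and> r x \<le> C"
      then have "0 < inverse (r x)" "inverse (r x) \<le> inverse q"
        using c by auto
      then show "0 < q \<and> q \<le> r x"
        by (metis inverse_le_imp_le inverse_positive_iff_positive less_le_trans)
    qed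
    \<comment> \<open>A statement free of \<open>x\<close> that holds almost everywhere holds
      outright, as a probability measure is not null.\<close>
    then have "0 < q"
      by simp
    have "q \<le> 1"
      using integral_mono_AE[of \<mu>\<^sub>1 "\<lambda>_. q" r] r_int r_1 q by (simp add: P1.prob_space)
    have "AE x in \<mu>\<^sub>1. e / max Z\<^sub>1 Z\<^sub>2 * q * l x \<le> \<bar>s x / Z\<^sub>1 - s x * r x / Z\<^sub>2\<bar>"
      using s_ge q
    proof eventually_elim
      fix x assume x: "e \<le> s x" "0 < q \<and> q \<le> r x"
      then have "0 < r x"
        by simp
      \<comment> \<open>Dual to the upper bound: \<open>q\<close> is below both numerators, 1 and
        \<open>r x\<close>.\<close>
      have "q / max Z\<^sub>1 Z\<^sub>2 \<le> min (1 / Z\<^sub>1) (r x / Z\<^sub>2)"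
        using \<open>q \<le> 1\<close> x Z by (auto intro!: frac_le)
      then have "q / max Z\<^sub>1 Z\<^sub>2 * l x \<le> \<bar>1 / Z\<^sub>1 - r x / Z\<^sub>2\<bar>"
        using min_ln_le_abs_diff[of "1 / Z\<^sub>1" "r x / Z\<^sub>2"] Z \<open>0 < r x\<close>
        unfolding l_eq[OF \<open>0 < r x\<close>]
        by (meson abs_ge_zero divide_pos_pos mult_right_mono order_trans zero_less_one)
      then have "e * (q / max Z\<^sub>1 Z\<^sub>2 * l x) \<le> s x * \<bar>1 / Z\<^sub>1 - r x / Z\<^sub>2\<bar>"
        using x s_pos[of x] Z by (intro mult_mono) (auto simp: l_def)
      then show "e / max Z\<^sub>1 Z\<^sub>2 * q * l x \<le> \<bar>s x / Z\<^sub>1 - s x * r x / Z\<^sub>2\<bar>"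
        unfolding d_eq by simp
    qed
    then have "(\<integral>x. e / max Z\<^sub>1 Z\<^sub>2 * q * l x \<partial>\<mu>\<^sub>1) \<le> (\<integral>x. \<bar>s x / Z\<^sub>1 - s x * r x / Z\<^sub>2\<bar> \<partial>\<mu>\<^sub>1)"
      using s_int sr_int l_int by (intro integral_mono_AE) auto
    then show ?thesis
      unfolding tv_post l_norm q_def[symmetric] e_def[symmetric] by simp
  qed
  show ?thesis
    using upper Z_diff lower by simp
qed

end
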